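(* Let $q \geq 2$ be an integer, and let $(C_n)_{n\ge 1}$ be a family of codes such that, for each $n$, $C_n \subseteq \{0,1,\ldots,q-1\}^n$ is a $q$-ary $\overline{2}$-separable code of length $n$. Then $$\limsup_{n \to \infty} \frac{1}{n} \log_q |C_n| \leq \frac{2q-1}{3q-1}.$$
   Context: A $q$-ary code of length $n$ is a subset $C_n \subseteq \{0,1,\ldots,q-1\}^n$; its elements are called codewords, and $c(i)$ denotes the $i$-th component of a codeword $c$. For a set $A$ of codewords and a coordinate $i$, write $A(i) = \{c(i) : c \in A\}$ (the union of the symbols of the codewords of $A$ at coordinate $i$). The code $C_n$ is $\overline{2}$-separable if for any two distinct subsets $A, B \subseteq C_n$ with $1 \leq |A| \leq 2$ and $1 \leq |B| \leq 2$ there exists a coordinate $i$, $1 \leq i \leq n$, such that $A(i) \neq B(i)$. By convention $\log_q 0 = -\infty$. *)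

theory Defs
  imports Complex_Main "HOL-Library.FuncSet" "HOL-Library.Extended_Real"
begin

text \<open>Codewords of length \<open>n\<close> are functions on \<open>{1..n}\<close>, made extensional (\<open>undefined\<close> outside
  \<open>{1..n}\<close>) so that equal codewords are equal functions and \<open>card\<close> counts codewords.\<close>

definition is_code :: "nat \<Rightarrow> nat \<Rightarrow> (nat \<Rightarrow> nat) set \<Rightarrow> bool" where
  "is_code q n C \<longleftrightarrow> C \<subseteq> {1..n} \<rightarrow>\<^sub>E {0..<q}"

definition symbols_at :: "(nat \<Rightarrow> nat) set \<Rightarrow> nat \<Rightarrow> nat set" where
  "symbols_at A i = {c i | c. c \<in> A}"

definition two_separable :: "nat \<Rightarrow> (nat \<Rightarrow> nat) set \<Rightarrow> bool" where
  "two_separable n C \<longleftrightarrow>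
    (\<forall>A B. A \<subseteq> C \<longrightarrow> B \<subseteq> C \<longrightarrow> A \<noteq> B \<longrightarrow>
      1 \<le> card A \<longrightarrow> card A \<le> 2 \<longrightarrow> 1 \<le> card B \<longrightarrow> card B \<le> 2 \<longrightarrow>
      (\<exists>i\<in>{1..n}. symbols_at A i \<noteq> symbols_at B i))"

text \<open>The library has \<open>log b 0 = 0\<close>; the convention needed here is \<open>log b 0 = -\<infinity>\<close>.\<close>

definition elog :: "nat \<Rightarrow> nat \<Rightarrow> ereal" where
  "elog b m = (if m = 0 then -\<infinity> else ereal (log (real b) (real m)))"

end

theory Submission
  imports Defs "HOL-Analysis.Complex_Transcendental"
begin

text \<open>
  The proof generalises Lindstroem's argument for binary Sidon sets. Give an ordered pair of
  codewords \<open>(a, b)\<close> the \<^emph>\<open>difference pattern\<close> that records, at each coordinate, the pair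
  \<open>(a i, b i)\<close> if \<open>a i \<noteq> b i\<close>, and only a blank if \<open>a i = b i\<close>. If \<open>(a, b)\<close> and \<open>(c, d)\<close> have the
  same pattern, then \<open>{a, d}\<close> and \<open>{b, c}\<close> show the same symbols at every coordinate, so
  separability makes them equal: a pair with \<open>a \<noteq> b\<close> is determined by its pattern
  (\<open>pair_determined_by_differences\<close>).

  Only pairs that agree on the first \<open>k\<close> coordinates are counted; their patterns are blank
  there, and live on the remaining \<open>m = n - k\<close> coordinates. Give the blank probability \<open>1/q\<close> and
  each of the \<open>q (q - 1)\<close> other symbols probability \<open>1/q\<^sup>2\<close>. By injectivity, the product
  probabilities of the patterns that occur add up to at most 1
  (\<open>sum_difference_weights_le_1\<close>). On the other hand, \<open>a\<close> and \<open>b\<close> range independently over the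
  words with a given prefix, so by Cauchy--Schwarz they agree at each coordinate with frequency
  at least \<open>1/q\<close> (\<open>card_collisions_refine\<close>). The logarithm to base \<open>q\<close> of the weight is therefore on average
  about \<open>- (2 - 1/q) m\<close> or more, and by convexity the number of pairs is at most about
  \<open>q\<close> to the power \<open>(2 - 1/q) m\<close>. With \<open>N\<close> codewords there are at least about
  \<open>N\<^sup>2 / q ^ k\<close> such pairs, again by Cauchy--Schwarz.

  A large \<open>k\<close> gives the best bound, but \<open>q ^ k\<close> has to stay small compared with \<open>N\<close>, so that the
  trivial pairs \<open>a = b\<close> are negligible. Taking \<open>q ^ k\<close> close to \<open>N / n\<close> and writing \<open>R\<close> for the
  rate, one gets \<open>2 R - R \<le> (2 - 1/q) (1 - R)\<close> up to \<open>O(log n / n)\<close>, that is,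
  \<open>R \<le> (2 q - 1) / (3 q - 1)\<close>.
\<close>

section \<open>Counting collisions\<close>

definition collisions :: "('a \<Rightarrow> 'b) \<Rightarrow> 'a set \<Rightarrow> ('a \<times> 'a) set" where
  "collisions g A = {(a, b) \<in> A \<times> A. g a = g b}"

lemma finite_collisions: "finite A \<Longrightarrow> finite (collisions g A)"
  unfolding collisions_def by (rule finite_subset[of _ "A \<times> A"]) auto

lemma card_collisions:
  assumes "finite A" "finite B" "g ` A \<subseteq> B"
  shows "card (collisions g A) = (\<Sum>u\<in>B. (card {a \<in> A. g a = u})\<^sup>2)"
proof -
  have "collisions g A = (\<Union>u\<in>B. {a \<in> A. g a = u} \<times> {a \<in> A. g a = u})"
    using assms(3) by (auto simp: collisions_def)
  moreover have "card (\<Union>u\<in>B. {a \<in> A. g a = u} \<times> {a \<in> A. g a = u})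
      = (\<Sum>u\<in>B. card ({a \<in> A. g a = u} \<times> {a \<in> A. g a = u}))"
    by (rule card_UN_disjoint) (use assms in auto)
  ultimately show ?thesis
    by (simp add: card_cartesian_product power2_eq_square)
qed

text \<open>Cauchy--Schwarz, applied to the sizes of the fibres of \<open>g\<close>.\<close>

lemma card_square_le_collisions:
  assumes "finite A" "finite B" "g ` A \<subseteq> B"
  shows "(card A)\<^sup>2 \<le> card B * card (collisions g A)"
proof -
  have "card A = (\<Sum>u\<in>B. card {a \<in> A. g a = u})"
    using sum.group[OF assms, of "\<lambda>_. 1 :: nat"] by simp
  then have "(real (card A))\<^sup>2 = (\<Sum>u\<in>B. real (card {a \<in> A. g a = u}))\<^sup>2"
    by simp
  also have "\<dots> \<le> (\<Sum>u\<in>B. (real (card {a \<in> A. g a = u}))\<^sup>2) * card B"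
    by (rule sum_squared_le_sum_of_squares)
  also have "\<dots> = real (card B * card (collisions g A))"
    by (simp add: card_collisions[OF assms] mult.commute)
  finally have "real ((card A)\<^sup>2) \<le> real (card B * card (collisions g A))"
    by simp
  then show ?thesis by (simp only: of_nat_le_iff)
qed

text \<open>The same bound inside each fibre of \<open>p\<close>: among the pairs that collide under \<open>p\<close>, at least
  one in \<open>card B\<close> also collides under \<open>g\<close>.\<close>

lemma card_collisions_refine:
  assumes "finite A" "finite B" "g ` A \<subseteq> B"
  shows "card (collisions p A) \<le> card B * card {(a, b) \<in> collisions p A. g a = g b}"
proof -
  define F where "F u = {a \<in> A. p a = u}" for u
  have fin: "finite (F u)" for u using assms(1) by (simp add: F_def)
  have "{(a, b) \<in> collisions p A. g a = g b} = (\<Union>u\<in>p ` A. collisions g (F u))"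
    by (auto simp: collisions_def F_def)
  moreover have "card (\<Union>u\<in>p ` A. collisions g (F u)) = (\<Sum>u\<in>p ` A. card (collisions g (F u)))"
    by (rule card_UN_disjoint) (use assms(1) finite_collisions[OF fin] in auto, auto simp: collisions_def F_def)
  ultimately have eq: "card {(a, b) \<in> collisions p A. g a = g b}
      = (\<Sum>u\<in>p ` A. card (collisions g (F u)))"
    by simp
  have "card (collisions p A) = (\<Sum>u\<in>p ` A. (card (F u))\<^sup>2)"
    unfolding F_def by (rule card_collisions) (use assms in auto)
  also have "\<dots> \<le> (\<Sum>u\<in>p ` A. card B * card (collisions g (F u)))"
    by (intro sum_mono card_square_le_collisions fin assms(2)) (use assms(3) in \<open>auto simp: F_def\<close>)
  finally show ?thesis by (simp add: eq sum_distrib_left)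
qed

section \<open>Difference patterns of pairs of codewords\<close>

lemma pair_determined_by_differences:
  assumes "two_separable n C" "a \<in> C" "b \<in> C" "c \<in> C" "d \<in> C" "a \<noteq> b"
    and "\<And>i. i \<in> {1..n} \<Longrightarrow> (a i = b i \<and> c i = d i) \<or> (a i = c i \<and> b i = d i)"
  shows "a = c \<and> b = d"
proof -
  have card12: "1 \<le> card {x, y} \<and> card {x, y} \<le> 2" for x y :: "nat \<Rightarrow> nat"
    by (cases "x = y") auto
  have at: "symbols_at {x, y} i = {x i, y i}" for x y :: "nat \<Rightarrow> nat" and i
    by (auto simp: symbols_at_def)
  have "symbols_at {a, d} i = symbols_at {b, c} i" if "i \<in> {1..n}" for i
    using assms(7)[OF that] by (auto simp: at)
  then have "{a, d} = {b, c}"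
    using assms(1-5) card12[of a d] card12[of b c] unfolding two_separable_def
    by (metis empty_subsetI insert_subset)
  then show ?thesis using assms(6) by (metis insertE insertI1 singletonD)
qed

definition difference_pattern ::
    "nat set \<Rightarrow> (nat \<Rightarrow> nat) \<times> (nat \<Rightarrow> nat) \<Rightarrow> nat \<Rightarrow> (nat \<times> nat) option" where
  "difference_pattern J = (\<lambda>(a, b). \<lambda>i\<in>J. if a i = b i then None else Some (a i, b i))"

lemma inj_on_difference_pattern:
  assumes "two_separable n C" "J \<subseteq> {1..n}" "p = (\<lambda>a. restrict a ({1..n} - J))"
  shows "inj_on (difference_pattern J) {(a, b) \<in> collisions p C. a \<noteq> b}"
proof (rule inj_onI, clarify)
  fix a b c d
  assume ab: "(a, b) \<in> collisions p C" "a \<noteq> b" and cd: "(c, d) \<in> collisions p C" "c \<noteq> d"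
    and eq: "difference_pattern J (a, b) = difference_pattern J (c, d)"
  have "(a i = b i \<and> c i = d i) \<or> (a i = c i \<and> b i = d i)" if i: "i \<in> {1..n}" for i
  proof (cases "i \<in> J")
    case True
    then show ?thesis using fun_cong[OF eq, of i]
      by (auto simp: difference_pattern_def split: if_splits)
  next
    case False
    then have "p x i = x i" for x using i by (simp add: assms(3))
    moreover have "p a = p b" "p c = p d" using ab cd by (auto simp: collisions_def)
    ultimately show ?thesis by metis
  qed
  moreover have "a \<in> C" "b \<in> C" "c \<in> C" "d \<in> C"
    using ab cd by (auto simp: collisions_def)
  ultimately show "a = c \<and> b = d"
    by (intro pair_determined_by_differences[OF assms(1) _ _ _ _ ab(2)])
qed

text \<open>The weights \<open>1/q\<close> for a blank and \<open>1/q\<^sup>2\<close> for a pair of distinct symbols form a probability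
  distribution: the law of the difference symbol of two independent uniform symbols. Among
  independent, identically distributed symbols the uniform ones give the difference symbol of
  largest entropy.\<close>

lemma sum_difference_weights_le_1:
  fixes q :: nat
  assumes "q \<ge> 2" "is_code q n C" "two_separable n C" "J \<subseteq> {1..n}"
    and "p = (\<lambda>a. restrict a ({1..n} - J))"
  shows "(\<Sum>(a, b)\<in>{(a, b) \<in> collisions p C. a \<noteq> b}.
            \<Prod>i\<in>J. if a i = b i then 1 / real q else 1 / (real q)\<^sup>2) \<le> 1"
    (is "?lhs \<le> 1")
proof -
  define D where "D = {(x, y) \<in> {0..<q} \<times> {0..<q}. x \<noteq> y}"
  define S where "S = insert None (Some ` D)"
  define r where "r s = (case s of None \<Rightarrow> 1 / real q | Some _ \<Rightarrow> 1 / (real q)\<^sup>2)"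
    for s :: "(nat \<times> nat) option"
  define M where "M = {(a, b) \<in> collisions p C. a \<noteq> b}"
  have finJ: "finite J" using assms(4) by (rule finite_subset) simp
  have finD: "finite D" unfolding D_def by (rule finite_subset[of _ "{0..<q} \<times> {0..<q}"]) auto
  have finS: "finite S" using finD by (simp add: S_def)
  have "D = {0..<q} \<times> {0..<q} - (\<lambda>x. (x, x)) ` {0..<q}" by (auto simp: D_def)
  moreover have "card ((\<lambda>x. (x, x)) ` {0..<q}) = q"
    by (subst card_image) (auto simp: inj_on_def)
  ultimately have cardD: "card D = q * q - q"
    by (simp add: card_Diff_subset image_subset_iff)
  have "sum r S = 1 / real q + (\<Sum>s\<in>Some ` D. r s)"
    unfolding S_def using finD by (subst sum.insert) (auto simp: r_def)
  also have "(\<Sum>s\<in>Some ` D. r s) = real (q * q - q) / (real q)\<^sup>2"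
    by (subst sum.reindex) (auto simp: r_def cardD)
  also have "1 / real q + real (q * q - q) / (real q)\<^sup>2 = 1"
    using assms(1) by (simp add: of_nat_diff field_simps power2_eq_square)
  finally have sum1: "sum r S = 1" .
  have range: "difference_pattern J ` M \<subseteq> J \<rightarrow>\<^sub>E S"
  proof (clarify)
    fix a b assume "(a, b) \<in> M"
    then have "a \<in> C" "b \<in> C" by (auto simp: M_def collisions_def)
    then have "a i < q" "b i < q" if "i \<in> J" for i
      using assms(2,4) that unfolding is_code_def by (fastforce dest: PiE_mem)+
    then show "difference_pattern J (a, b) \<in> J \<rightarrow>\<^sub>E S"
      by (auto simp: difference_pattern_def S_def D_def)
  qed
  have "?lhs = (\<Sum>x\<in>M. \<Prod>i\<in>J. r (difference_pattern J x i))"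
    unfolding M_def
    by (rule sum.cong) (auto simp: difference_pattern_def r_def intro!: prod.cong)
  also have "\<dots> = (\<Sum>s\<in>difference_pattern J ` M. \<Prod>i\<in>J. r (s i))"
    using inj_on_difference_pattern[OF assms(3-5)]
    by (subst sum.reindex) (auto simp: M_def)
  also have "\<dots> \<le> (\<Sum>s\<in>J \<rightarrow>\<^sub>E S. \<Prod>i\<in>J. r (s i))"
    by (rule sum_mono2)
      (use range finJ finS in \<open>auto intro!: finite_PiE prod_nonneg simp: r_def split: option.splits\<close>)
  also have "\<dots> = (\<Prod>i\<in>J. sum r S)"
    by (rule prod_sum_PiE[symmetric]) (use finJ finS in auto)
  finally show ?thesis by (simp add: sum1)
qed

section \<open>A bound for every length\<close>

text \<open>Jensen's inequality for the exponential function.\<close>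

lemma card_powr_mean_le_sum:
  fixes f :: "'a \<Rightarrow> real" and q :: real
  assumes "finite A" "A \<noteq> {}" "q > 0"
  shows "real (card A) * q powr (sum f A / card A) \<le> (\<Sum>x\<in>A. q powr f x)"
proof -
  have A: "card A > 0" using assms by (simp add: card_gt_0_iff)
  have "exp (\<Sum>x\<in>A. (1 / card A) *\<^sub>R (f x * ln q)) \<le> (\<Sum>x\<in>A. 1 / card A * exp (f x * ln q))"
    by (rule convex_on_sum[OF assms(1,2) exp_convex]) (use A in auto)
  then have "q powr (sum f A / card A) \<le> (\<Sum>x\<in>A. q powr f x) / card A"
    using assms(3) by (simp add: powr_def sum_divide_distrib sum_distrib_right)
  then show ?thesis using A by (simp add: field_simps)
qed

text \<open>Weights against counts: a pair weighs \<open>q\<close> to the power of its number of agreements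
  on \<open>J\<close> minus \<open>2 card J\<close>, so many agreements on average leave room for few pairs.\<close>

lemma log_card_pairs_le:
  fixes q :: nat
  assumes "q \<ge> 2" "is_code q n C" "two_separable n C" "J \<subseteq> {1..n}"
    and "p = (\<lambda>a. restrict a ({1..n} - J))" "M = {(a, b) \<in> collisions p C. a \<noteq> b}"
    and "M \<noteq> {}" "finite C"
  shows "log q (card M) \<le> 2 * real (card J)
           - real (\<Sum>(a, b)\<in>M. card {i \<in> J. a i = b i}) / card M"
proof -
  define t where "t = (\<lambda>(a :: nat \<Rightarrow> nat, b :: nat \<Rightarrow> nat). real (card {i \<in> J. a i = b i}) - 2 * real (card J))"
  have finJ: "finite J" using assms(4) by (rule finite_subset) simp
  have finM: "finite M" unfolding assms(6)
    by (rule finite_subset[OF _ finite_collisions[OF assms(8), of p]]) auto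
  have weight: "(\<Prod>i\<in>J. if a i = b i then 1 / real q else 1 / (real q)\<^sup>2) = real q powr t (a, b)"
    for a b :: "nat \<Rightarrow> nat"
  proof -
    have "(\<Prod>i\<in>J. if a i = b i then 1 / real q else 1 / (real q)\<^sup>2)
        = (\<Prod>i\<in>J. real q powr ((if a i = b i then 1 else 0) - 2))"
      using assms(1) by (intro prod.cong) (auto simp: powr_minus_divide)
    also have "\<dots> = real q powr (\<Sum>i\<in>J. (if a i = b i then 1 else 0) - 2)"
      using assms(1) finJ by (simp add: powr_sum)
    also have "(\<Sum>i\<in>J. (if a i = b i then 1 else 0) - 2) = t (a, b)"
      using finJ by (simp add: t_def sum_subtractf sum.If_cases Int_def)
    finally show ?thesis .
  qed
  have Mpos: "card M > 0" using finM assms(7) by (simp add: card_gt_0_iff)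
  have "real (card M) * real q powr (sum t M / card M) \<le> (\<Sum>x\<in>M. real q powr t x)"
    by (rule card_powr_mean_le_sum) (use finM assms in auto)
  also have "\<dots> \<le> 1"
    using sum_difference_weights_le_1[OF assms(1-5)] by (simp add: weight assms(6) case_prod_unfold)
  finally have "log q (real (card M) * real q powr (sum t M / card M)) \<le> 0"
    using assms(1) Mpos by (subst log_le_zero_cancel_iff) auto
  then have "log q (card M) + sum t M / card M \<le> 0"
    using assms(1) Mpos by (simp add: log_mult)
  moreover have "sum t M = real (\<Sum>(a, b)\<in>M. card {i \<in> J. a i = b i})
      - 2 * real (card J) * card M"
    by (simp add: t_def case_prod_unfold sum_subtractf)
  ultimately show ?thesis using Mpos by (simp add: diff_divide_distrib)
qed

text \<open>Summing over the coordinates of \<open>J\<close> the number of pairs that agree there; the trivial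
  pairs, which agree everywhere, are taken out again.\<close>

lemma sum_agreements_ge:
  fixes q :: nat
  assumes "is_code q n C" "J \<subseteq> {1..n}" "finite C"
    and "M = {(a, b) \<in> collisions p C. a \<noteq> b}"
  shows "card J * card (collisions p C)
      \<le> q * ((\<Sum>(a, b)\<in>M. card {i \<in> J. a i = b i}) + card J * card C)"
proof -
  define P where "P = collisions p C"
  have finJ: "finite J" using assms(2) by (rule finite_subset) simp
  have finP: "finite P" unfolding P_def by (rule finite_collisions[OF assms(3)])
  have split: "P = M \<union> (\<lambda>a. (a, a)) ` C" "M \<inter> (\<lambda>a. (a, a)) ` C = {}"
    unfolding assms(4) P_def by (auto simp: collisions_def)
  then have finM: "finite M" using finP by simp
  have "card J * card P = (\<Sum>i\<in>J. card P)" by simp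
  also have "\<dots> \<le> (\<Sum>i\<in>J. q * card {(a, b) \<in> P. a i = b i})"
  proof (rule sum_mono)
    fix i assume "i \<in> J"
    then have "(\<lambda>a. a i) ` C \<subseteq> {0..<q}" using assms(1,2) unfolding is_code_def by fastforce
    from card_collisions_refine[OF assms(3) _ this, of p]
    show "card P \<le> q * card {(a, b) \<in> P. a i = b i}" by (simp add: P_def)
  qed
  also have "\<dots> = q * (\<Sum>i\<in>J. card {(a, b) \<in> P. a i = b i})"
    by (simp add: sum_distrib_left)
  also have "(\<Sum>i\<in>J. card {(a, b) \<in> P. a i = b i})
      = (\<Sum>i\<in>J. \<Sum>x\<in>P. if fst x i = snd x i then 1 else 0)"
    using finP by (intro sum.cong) (auto simp: sum.If_cases Int_def case_prod_unfold)
  also have "\<dots> = (\<Sum>x\<in>P. \<Sum>i\<in>J. if fst x i = snd x i then 1 else 0)"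
    by (rule sum.swap)
  also have "\<dots> = (\<Sum>(a, b)\<in>P. card {i \<in> J. a i = b i})"
    using finJ by (intro sum.cong) (auto simp: sum.If_cases Int_def)
  also have "\<dots> = (\<Sum>(a, b)\<in>M. card {i \<in> J. a i = b i})
      + (\<Sum>(a, b)\<in>(\<lambda>a. (a, a)) ` C. card {i \<in> J. a i = b i})"
    unfolding split(1) by (rule sum.union_disjoint) (use finM assms(3) split(2) in auto)
  also have "(\<Sum>(a, b)\<in>(\<lambda>a. (a, a)) ` C. card {i \<in> J. a i = b i}) = card J * card C"
    by (subst sum.reindex) (auto simp: inj_on_def)
  finally show ?thesis by (simp add: P_def)
qed

lemma finite_code: "is_code q n C \<Longrightarrow> finite C"
  unfolding is_code_def by (erule finite_subset) (simp add: finite_PiE)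

lemma card_code_le: "is_code q n C \<Longrightarrow> card C \<le> q ^ n"
  unfolding is_code_def by (drule card_mono[rotated]) (auto simp: card_PiE finite_PiE)

text \<open>The assumption \<open>n * q ^ k \<le> card C\<close> makes the pairs with a common prefix of length \<open>k\<close> at
  least \<open>n\<close> times as many as the trivial pairs, which then cost only the additive
  constant.\<close>

lemma log_card_le_of_prefix:
  fixes q :: nat
  assumes q: "q \<ge> 2" and code: "is_code q n C" and sep: "two_separable n C"
    and n: "n \<ge> 2" and k: "k \<le> n" "n * q ^ k \<le> card C"
  shows "2 * log q (card C) - k \<le> (2 - 1 / q) * (real n - real k) + 2"
proof -
  define J where "J = {k + 1..n}"
  define p where "p = (\<lambda>a :: nat \<Rightarrow> nat. restrict a ({1..n} - J))"
  define M where "M = {(a, b) \<in> collisions p C. a \<noteq> b}"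
  define N where "N = real (card C)"
  define P where "P = real (card (collisions p C))"
  define A where "A = real (\<Sum>(a, b)\<in>M. card {i \<in> J. a i = b i})"
  have finC: "finite C" using code by (rule finite_code)
  have J: "J \<subseteq> {1..n}" "real (card J) = real n - real k" using k by (auto simp: J_def)
  have prefix: "{1..n} - J = {1..k}" using k by (auto simp: J_def)
  have qk: "real q ^ k > 0" using q by simp
  have Nge: "real n * real q ^ k \<le> N"
    using k(2) unfolding N_def by (metis of_nat_le_iff of_nat_mult of_nat_power)
  have Npos: "N > 0"
    by (rule less_le_trans[OF _ Nge]) (use qk n in simp)
  have "p ` C \<subseteq> {1..k} \<rightarrow>\<^sub>E {0..<q}"
    using code k(1) unfolding p_def prefix is_code_def by fastforce
  from card_square_le_collisions[OF finC _ this]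
  have "(card C)\<^sup>2 \<le> q ^ k * card (collisions p C)"
    by (simp add: finite_PiE card_PiE)
  then have NP: "N\<^sup>2 \<le> real q ^ k * P"
    unfolding N_def P_def by (metis of_nat_le_iff of_nat_mult of_nat_power)
  have "real n * N * real q ^ k \<le> N\<^sup>2"
    using mult_right_mono[OF Nge, of N] Npos by (simp add: power2_eq_square mult_ac)
  then have "real n * N * real q ^ k \<le> P * real q ^ k" using NP by (simp add: mult.commute)
  then have nN: "real n * N \<le> P" using qk by simp
  have "2 * N \<le> real n * N" using n Npos by simp
  then have P2: "2 * N \<le> P" using nN by simp
  then have Ppos: "P > 0" using Npos by simp
  have split: "collisions p C = M \<union> (\<lambda>a. (a, a)) ` C" "M \<inter> (\<lambda>a. (a, a)) ` C = {}"
    unfolding M_def by (auto simp: collisions_def)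
  then have finM: "finite M" using finite_collisions[OF finC, of p] by simp
  have "card (collisions p C) = card M + card C"
    unfolding split(1) by (subst card_Un_disjoint)
      (use split(2) finM finC in \<open>auto simp: card_image inj_on_def\<close>)
  then have M: "real (card M) = P - N" by (simp add: P_def N_def)
  then have Mpos: "real (card M) > 0" "real (card M) \<le> P" using P2 Npos by simp_all
  then have "M \<noteq> {}" by auto
  have up: "log q (card M) \<le> 2 * (real n - real k) - A / card M"
    using log_card_pairs_le[OF q code sep J(1) p_def M_def \<open>M \<noteq> {}\<close> finC] J(2)
    by (simp add: A_def)
  \<comment> \<open>Each coordinate loses at most \<open>N / P \<le> 1 / n\<close> of its \<open>1 / q\<close> agreements to the trivial pairs,
    hence all together at most 1.\<close>
  have "real (card J) * P \<le> q * (A + real (card J) * N)"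
    using sum_agreements_ge[OF code J(1) finC M_def, folded of_nat_le_iff[where ?'a = real]]
    unfolding A_def P_def N_def of_nat_mult of_nat_add .
  then have "(real n - real k) * P / q \<le> A + (real n - real k) * N"
    using q J(2) by (simp add: pos_divide_le_eq mult.commute)
  moreover have "(real n - real k) * N \<le> real n * N"
    using Npos by (intro mult_right_mono) auto
  ultimately have "(real n - real k) * P / q \<le> A + P" using nN by linarith
  then have "(real n - real k) / q - 1 \<le> A / P"
    using Ppos by (simp add: pos_le_divide_eq left_diff_distrib)
  also have "A / P \<le> A / card M"
  proof (rule divide_left_mono)
    show "0 \<le> A" unfolding A_def by (rule of_nat_0_le_iff)
  qed (use Mpos Ppos in auto)
  finally have agr: "(real n - real k) / q - 1 \<le> A / card M" .
  have "N\<^sup>2 \<le> real q ^ k * (2 * real (card M))"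
    by (rule order_trans[OF NP mult_left_mono]) (use M P2 qk in auto)
  then have "log q (N\<^sup>2) \<le> log q (real q ^ k * (2 * real (card M)))"
    using Npos q qk Mpos by simp
  then have "2 * log q N \<le> k + log q 2 + log q (card M)"
    using Npos q qk Mpos by (simp add: log_mult log_nat_power)
  moreover have "log q 2 \<le> 1" using q by simp
  ultimately have "2 * log q N - k \<le> 1 + (2 * (real n - real k) - ((real n - real k) / q - 1))"
    using up agr by linarith
  then show ?thesis by (simp add: N_def algebra_simps diff_divide_distrib)
qed

text \<open>The longest prefix for which the previous bound applies has \<open>q ^ k\<close> equal to \<open>card C / n\<close> up
  to a factor \<open>q\<close>.\<close>

lemma log_card_le:
  fixes q :: nat
  assumes q: "q \<ge> 2" and code: "is_code q n C" and sep: "two_separable n C"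
    and n: "n \<ge> 2" and C: "C \<noteq> {}"
  shows "(3 * real q - 1) * log q (card C) \<le> (2 * real q - 1) * n + q * (3 + log q n)"
proof -
  define L where "L = log q (card C)"
  have cardC: "card C > 0" using C finite_code[OF code] by (simp add: card_gt_0_iff)
  have lognn: "log q n \<ge> 0" using q n by simp
  have key: "2 * L - k \<le> (2 - 1 / real q) * (real n - k) + 2 \<Longrightarrow> L \<le> k + 1 + log q n \<Longrightarrow>
      (3 * real q - 1) * L \<le> (2 * real q - 1) * n + q * (3 + log q n)" for k :: real
  proof -
    assume 1: "2 * L - k \<le> (2 - 1 / real q) * (real n - k) + 2" and 2: "L \<le> k + 1 + log q n"
    have "q * (2 * L - k) \<le> q * ((2 - 1 / real q) * (real n - k) + 2)"
      using 1 q by (intro mult_left_mono) auto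
    also have "\<dots> = (2 * real q - 1) * (n - k) + 2 * q"
      using q by (simp add: field_simps)
    finally have a: "q * (2 * L - k) \<le> (2 * real q - 1) * (n - k) + 2 * q" .
    have b: "(real q - 1) * L \<le> (real q - 1) * (k + 1 + log q n)"
      using 2 q by (intro mult_left_mono) auto
    show ?thesis using a b lognn by (simp add: algebra_simps)
  qed
  show ?thesis
  proof (cases "card C < n")
    case True
    then have "L \<le> log q n" unfolding L_def using q cardC by simp
    then have "(3 * real q - 1) * L \<le> 3 * q * log q n - log q n"
      using mult_left_mono[of L "log q n" "3 * real q - 1"] q by (simp add: algebra_simps)
    \<comment> \<open>It remains to absorb \<open>(2 q - 1) log q n\<close>, as \<open>log q n \<le> n\<close>.\<close>
    moreover have "(2 * real q - 1) * log q n \<le> (2 * real q - 1) * n"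
    proof (rule mult_left_mono)
      have "real n \<le> real q ^ n"
        using q by (metis less_exp less_imp_le of_nat_le_iff of_nat_power order.trans power_mono zero_le)
      then show "log q n \<le> n" using q n by (simp add: log_le_iff powr_realpow)
    qed (use q in simp)
    ultimately show ?thesis by (simp add: L_def algebra_simps)
  next
    case False
    define k where "k = nat \<lfloor>L - log q n\<rfloor>"
    have "log q n \<le> L" unfolding L_def using False q n by simp
    then have k: "real k \<le> L - log q n" "L - log q n \<le> k + 1"
      unfolding k_def by linarith+
    have "L \<le> n"
      using card_code_le[OF code] q cardC unfolding L_def
      by (simp add: log_le_iff powr_realpow)
    then have kn: "k \<le> n" using k lognn by linarith
    have "log q (real n * real q ^ k) = log q n + k"
      using q n by (simp add: log_mult log_nat_power)
    also have "\<dots> \<le> log q (card C)" using k by (simp add: L_def)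
    finally have "real n * real q ^ k \<le> card C" using q n cardC by simp
    then have "n * q ^ k \<le> card C" by (metis of_nat_le_iff of_nat_mult of_nat_power)
    from log_card_le_of_prefix[OF q code sep n kn this]
    have "2 * L - k \<le> (2 - 1 / q) * (real n - real k) + 2" by (simp add: L_def)
    then show ?thesis using key k by (simp add: L_def)
  qed
qed

section \<open>The rate\<close>

theorem theorem2p1:
  fixes q :: nat and C :: "nat \<Rightarrow> (nat \<Rightarrow> nat) set"
  assumes "q \<ge> 2"
    and "\<And>n. n \<ge> 1 \<Longrightarrow> is_code q n (C n)"
    and "\<And>n. n \<ge> 1 \<Longrightarrow> two_separable n (C n)"
  shows "limsup (\<lambda>n. ereal (1 / real n) * elog q (card (C n)))
           \<le> ereal ((2 * real q - 1) / (3 * real q - 1))"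
proof -
  define B where "B n = ((2 * real q - 1) * n + q * (3 + log q n)) / ((3 * real q - 1) * n)"
    for n :: nat
  have "eventually (\<lambda>n. ereal (1 / real n) * elog q (card (C n)) \<le> ereal (B n)) sequentially"
    using eventually_ge_at_top[of 2]
  proof eventually_elim
    case (elim n)
    show ?case
    proof (cases "card (C n) = 0")
      case True
      then show ?thesis using elim by (simp add: elog_def)
    next
      case False
      then have "C n \<noteq> {}" by auto
      from log_card_le[OF assms(1) assms(2,3)[of n] _ this]
      have "(3 * real q - 1) * log q (card (C n)) \<le> (2 * real q - 1) * n + q * (3 + log q n)"
        using elim by simp
      then have "1 / real n * log q (card (C n)) \<le> B n"
        using assms(1) elim by (simp add: B_def pos_le_divide_eq pos_divide_le_eq mult_ac)
      then show ?thesis using False by (simp add: elog_def)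
    qed
  qed
  then have "limsup (\<lambda>n. ereal (1 / real n) * elog q (card (C n))) \<le> limsup (\<lambda>n. ereal (B n))"
    by (rule Limsup_mono)
  also have "limsup (\<lambda>n. ereal (B n)) = ereal ((2 * real q - 1) / (3 * real q - 1))"
  proof (rule lim_imp_Limsup)
    have "(\<lambda>n::nat. (2 * real q - 1) / (3 * real q - 1)
        + real q / (3 * real q - 1) * (3 / real n + log q n / n))
      \<longlonglongrightarrow> (2 * real q - 1) / (3 * real q - 1) + real q / (3 * real q - 1) * (0 + 0)"
      by (intro tendsto_intros)
    moreover have "eventually (\<lambda>n. (2 * real q - 1) / (3 * real q - 1)
        + real q / (3 * real q - 1) * (3 / real n + log q n / n) = B n) sequentially"
      using eventually_gt_at_top[of 0]
    proof eventually_elim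
      case (elim n)
      have frac: "a / d + c / d * (3 / m + l / m) = (a * m + c * (3 + l)) / (d * m)"
        if "d \<noteq> 0" "m \<noteq> 0" for a c d l m :: real
        using that by (simp add: field_simps)
      show ?case unfolding B_def by (rule frac) (use assms(1) elim in auto)
    qed
    ultimately have "B \<longlonglongrightarrow> (2 * real q - 1) / (3 * real q - 1)"
      by (simp add: tendsto_cong)
    then show "(\<lambda>n. ereal (B n)) \<longlonglongrightarrow> ereal ((2 * real q - 1) / (3 * real q - 1))"
      by simp
  qed (rule sequentially_bot)
  finally show ?thesis .
qed

end
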